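(* Let $m\ge 1$ be an integer and $f_m(x)=x^m(1-x)^m$. For every integer $k$ with $1\le k\le 2m$, the $k$-th derivative of $f_m$ satisfies $$f_m^{(k)}(x)=(-1)^m\sum_{j=\max\{k,m+1\}}^{2m}\frac{1+(-1)^j}{j}\binom{m}{j-m-1}\frac{j!}{(j-k)!}B_{j-k}(x)$$ $$\qquad=(-1)^m k!\sum_{j=\max\{k,m+1\}}^{2m}\frac{1+(-1)^j}{j}\binom{m}{j-m-1}\binom{j}{k}B_{j-k}(x).$$
   Context: $B_n(x)$ are the Bernoulli polynomials, defined by $\frac{te^{xt}}{e^t-1}=\sum_{n=0}^{\infty}B_n(x)\frac{t^n}{n!}$. *)

theory Defs
  imports "HOL-Analysis.Analysis" "HOL-Computational_Algebra.Formal_Power_Series"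
begin

text \<open>
  The Bernoulli polynomial \<open>B\<^sub>n(x)\<close>, as a function of \<open>x\<close>, is \<open>n!\<close> times the \<open>n\<close>-th coefficient of
  the formal power series \<open>t e\<^sup>x\<^sup>t / (e\<^sup>t - 1)\<close> in \<open>t\<close>. The denominator has zero constant term; the
  quotient is nevertheless exact, because the numerator is divisible by \<open>t\<close>
  (see \<open>bernoulli_poly_gen\<close>).
\<close>

definition bernoulli_poly :: "nat \<Rightarrow> 'a :: field_char_0 \<Rightarrow> 'a" where
  "bernoulli_poly n x = fact n * fps_nth (fps_X * fps_exp x / (fps_exp 1 - 1)) n"

lemma bernoulli_poly_gen:
  fixes x :: "'a :: field_char_0"
  shows "Abs_fps (\<lambda>n. bernoulli_poly n x / fact n) * (fps_exp 1 - 1) = fps_X * fps_exp x"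
proof -
  have nz: "fps_exp 1 - 1 \<noteq> (0 :: 'a fps)"
    by (auto simp: fps_eq_iff intro!: exI[of _ 1])
  have "subdegree (fps_exp 1 - 1 :: 'a fps) \<le> 1"
    by (intro subdegree_leI) simp
  moreover have "subdegree (fps_X * fps_exp x) \<ge> 1"
    by (intro subdegree_geI) (auto simp: fps_eq_iff intro!: exI[of _ 1])
  ultimately have "(fps_exp 1 - 1) dvd fps_X * fps_exp x"
    using nz by (subst fps_dvd_iff) auto
  moreover have "Abs_fps (\<lambda>n. bernoulli_poly n x / fact n) = fps_X * fps_exp x / (fps_exp 1 - 1)"
    by (simp add: fps_eq_iff bernoulli_poly_def)
  ultimately show ?thesis
    by simp
qed

end

theory Submission
  imports Defs
begin

text \<open>
  A polynomial over a field of characteristic zero is determined up to a constant by its forward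
  difference \<open>p(x + 1) - p(x)\<close>, since a polynomial of period one takes the same value at all natural
  numbers. The difference operator is simple on Bernoulli polynomials:
  \<open>B\<^sub>n(x + 1) - B\<^sub>n(x) = n x\<^sup>n\<^sup>-\<^sup>1\<close>. Expanding the difference
  \[ f_m(x+1) - f_m(x) = (-1)^m x^m (1+x)^m - x^m (1-x)^m \]
  by the binomial theorem and summing term by term therefore gives
  \[ f_m(x) = c + (-1)^m \sum_{j=m+1}^{2m} \frac{1+(-1)^j}{j} \binom{m}{j-m-1} B_j(x) \]
  for some constant \<open>c\<close>; the index \<open>j = 2m + 1\<close>, which the expansion also produces, is odd and has
  coefficient zero. This is \<open>beta_poly_eq_bernoulli_sum\<close>. Since \<open>B\<^sub>n' = n B\<^sub>n\<^sub>-\<^sub>1\<close>, differentiating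
  \<open>k \<ge> 1\<close> times removes \<open>c\<close>, annihilates the terms with \<open>j < k\<close> and turns every other \<open>B\<^sub>j\<close> into
  \<open>j! / (j - k)!\<close> times \<open>B\<^sub>j\<^sub>-\<^sub>k\<close>.
\<close>

section \<open>Bernoulli polynomials\<close>

abbreviation bernoulli_gf :: "'a :: field_char_0 \<Rightarrow> 'a fps" where
  "bernoulli_gf x \<equiv> Abs_fps (\<lambda>n. bernoulli_poly n x / fact n)"

lemma fps_exp_minus_1_nonzero: "fps_exp 1 - 1 \<noteq> (0 :: 'a :: field_char_0 fps)"
  by (auto simp: fps_eq_iff intro!: exI[of _ 1])

text \<open>
  Both sides agree after multiplication by \<open>e\<^sup>t - 1\<close>, which is nonzero and may be cancelled.
\<close>

lemma bernoulli_gf_eq: "bernoulli_gf x = bernoulli_gf 0 * fps_exp (x :: 'a :: field_char_0)"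
proof -
  have "bernoulli_gf x * (fps_exp 1 - 1) = bernoulli_gf 0 * (fps_exp 1 - 1) * fps_exp x"
    unfolding bernoulli_poly_gen fps_exp_0 mult_1_right ..
  also have "\<dots> = (bernoulli_gf 0 * fps_exp x) * (fps_exp 1 - 1)"
    by (simp only: mult_ac)
  finally show ?thesis
    by (rule mult_right_cancel[OF fps_exp_minus_1_nonzero, THEN iffD1])
qed

text \<open>
  Multiplying the generating function by \<open>e\<^sup>t - 1\<close> is the same as taking the forward difference in
  \<open>x\<close>, and the product is \<open>t e\<^sup>x\<^sup>t\<close> by definition.
\<close>

lemma bernoulli_poly_diff:
  fixes x :: "'a :: field_char_0"
  shows "bernoulli_poly (Suc n) (x + 1) - bernoulli_poly (Suc n) x = of_nat (Suc n) * x ^ n"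
proof -
  have "bernoulli_gf (x + 1) = bernoulli_gf 0 * (fps_exp x * fps_exp 1)"
    by (subst bernoulli_gf_eq) (simp only: fps_exp_add_mult)
  hence "bernoulli_gf (x + 1) - bernoulli_gf x = (bernoulli_gf 0 * fps_exp x) * (fps_exp 1 - 1)"
    by (subst (2) bernoulli_gf_eq) (simp only: algebra_simps mult_1_left)
  also have "\<dots> = fps_X * fps_exp x"
    by (simp only: bernoulli_gf_eq[of x, symmetric] bernoulli_poly_gen)
  finally have "fps_nth (bernoulli_gf (x + 1) - bernoulli_gf x) (Suc n) =
      fps_nth (fps_X * fps_exp x) (Suc n)"
    by (rule arg_cong)
  thus ?thesis
    by (simp add: divide_simps del: of_nat_Suc)
qed

text \<open>
  The Bernoulli polynomial as an element of the polynomial ring: comparing degrees and counting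
  roots, which the periodicity argument does, is not available for plain functions.
\<close>

definition bernoulli_pol :: "nat \<Rightarrow> 'a :: field_char_0 poly" where
  "bernoulli_pol n = (\<Sum>i\<le>n. monom (of_nat (n choose i) * bernoulli_poly i 0) (n - i))"

lemma poly_bernoulli_pol: "poly (bernoulli_pol n) x = bernoulli_poly n (x :: 'a :: field_char_0)"
proof -
  have "bernoulli_poly n x / fact n = fps_nth (bernoulli_gf 0 * fps_exp x) n"
    by (subst bernoulli_gf_eq[symmetric]) simp
  hence "bernoulli_poly n x = fact n * fps_nth (bernoulli_gf 0 * fps_exp x) n"
    by (simp only: nonzero_divide_eq_eq[OF fact_nonzero] mult.commute)
  also have "\<dots> =
      (\<Sum>i\<le>n. fact n * (bernoulli_poly i 0 / fact i * (x ^ (n - i) / fact (n - i))))"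
    by (simp add: fps_mult_nth atLeast0AtMost sum_distrib_left)
  also have "\<dots> = (\<Sum>i\<le>n. of_nat (n choose i) * bernoulli_poly i 0 * x ^ (n - i))"
    by (intro sum.cong refl) (simp add: binomial_fact)
  finally show ?thesis
    by (simp add: bernoulli_pol_def poly_sum poly_monom)
qed

lemma pderiv_bernoulli_pol:
  "pderiv (bernoulli_pol (Suc n)) = smult (of_nat (Suc n)) (bernoulli_pol n)"
proof -
  have *: "(Suc n - i) * (Suc n choose i) = Suc n * (n choose i)" if "i \<le> n" for i
    using binomial_absorb_comp[of "Suc n" i] by simp
  have "pderiv (bernoulli_pol (Suc n) :: 'a poly) =
      (\<Sum>i\<le>n. monom (of_nat (Suc n - i) * (of_nat (Suc n choose i) * bernoulli_poly i 0)) (n - i))"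
    by (simp add: bernoulli_pol_def higher_pderiv_sum[of "Suc 0", simplified] pderiv_add pderiv_monom
             del: of_nat_Suc of_nat_diff binomial_Suc_Suc)
  also have "\<dots> = (\<Sum>i\<le>n. monom (of_nat (Suc n * (n choose i)) * bernoulli_poly i 0) (n - i))"
    by (intro sum.cong refl) (simp only: * atMost_iff mult.assoc[symmetric] of_nat_mult[symmetric])
  finally show ?thesis
    by (simp add: bernoulli_pol_def poly_eq_iff coeff_sum sum_distrib_left mult.assoc
             del: of_nat_Suc) (auto intro!: sum.cong simp: algebra_simps)
qed

lemma higher_pderiv_bernoulli_pol:
  "(pderiv ^^ k) (bernoulli_pol n :: 'a :: field_char_0 poly) =
     (if k \<le> n then smult (fact n / fact (n - k)) (bernoulli_pol (n - k)) else 0)"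
proof (induction k)
  case (Suc k)
  show ?case
  proof (cases "Suc k \<le> n")
    case True
    then obtain d where d: "n = Suc k + d"
      using le_Suc_ex by blast
    hence "n - k = Suc d" "n - Suc k = d"
      by auto
    thus ?thesis
      using Suc d
      by (simp add: pderiv_smult pderiv_bernoulli_pol del: of_nat_Suc)
  next
    case False
    have "pderiv (bernoulli_pol 0 :: 'a poly) = 0"
      by (simp add: bernoulli_pol_def pderiv_monom)
    thus ?thesis
      using False Suc by (cases "k = n") (auto simp: pderiv_smult)
  qed
qed simp

section \<open>The expansion up to a constant\<close>

text \<open>
  The polynomial \<open>p - p(0)\<close> vanishes at every natural number, hence has infinitely many roots.
\<close>

lemma poly_periodic_imp_const:
  fixes p :: "'a :: field_char_0 poly"
  assumes "\<And>x. poly p (x + 1) = poly p x"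
  shows "p = [:poly p 0:]"
proof -
  have "poly p (of_nat n) = poly p 0" for n
  proof (induction n)
    case (Suc n)
    thus ?case
      using assms[of "of_nat n"] by (simp add: add.commute)
  qed simp
  hence "range of_nat \<subseteq> {x. poly (p - [:poly p 0:]) x = 0}"
    by auto
  moreover have "infinite (range (of_nat :: nat \<Rightarrow> 'a))"
    by (intro range_inj_infinite inj_of_nat)
  ultimately have "infinite {x. poly (p - [:poly p 0:]) x = 0}"
    by (rule infinite_super)
  hence "p - [:poly p 0:] = 0"
    by (metis poly_roots_finite)
  thus ?thesis
    by (simp only: right_minus_eq)
qed

definition beta_coeff :: "nat \<Rightarrow> nat \<Rightarrow> 'a :: field_char_0" where
  "beta_coeff m j = (1 + (-1) ^ j) / of_nat j * of_nat (m choose (j - m - 1))"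

lemma beta_coeff_bernoulli_diff:
  fixes x :: "'a :: field_char_0"
  shows "(\<Sum>j = m+1..2*m. beta_coeff m j * (bernoulli_poly j (x + 1) - bernoulli_poly j x)) =
           x ^ m * (1 + x) ^ m - (-1) ^ m * (x ^ m * (1 - x) ^ m)"
proof -
  let ?D = "\<lambda>j. bernoulli_poly j (x + 1) - bernoulli_poly j x"
  have "(\<Sum>j = m+1..2*m. beta_coeff m j * ?D j) = (\<Sum>j = m+1..2*m+1. beta_coeff m j * ?D j)"
    \<comment> \<open>the added index \<open>2m + 1\<close> is odd\<close>
    by (simp add: beta_coeff_def)
  also have "\<dots> = (\<Sum>i\<le>m. beta_coeff m (Suc (m + i)) * ?D (Suc (m + i)))"
    by (intro sum.reindex_bij_witness[of _ "\<lambda>i. Suc (m + i)" "\<lambda>j. j - m - 1"]) auto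
  also have "\<dots> = (\<Sum>i\<le>m. x ^ m * (of_nat (m choose i) * x ^ i) -
                         (-1) ^ m * (x ^ m * (of_nat (m choose i) * (-x) ^ i)))"
  proof (intro sum.cong refl)
    fix i
    have "beta_coeff m (Suc (m + i)) * ?D (Suc (m + i)) =
        (1 + (-1) ^ Suc (m + i)) * of_nat (m choose i) * x ^ (m + i)"
      by (simp add: beta_coeff_def bernoulli_poly_diff del: of_nat_Suc power_Suc)
    also have "\<dots> = x ^ m * (of_nat (m choose i) * x ^ i) -
        (-1) ^ m * (x ^ m * (of_nat (m choose i) * (-x) ^ i))"
      by (simp add: power_add power_minus[of x i] algebra_simps)
    finally show "beta_coeff m (Suc (m + i)) * ?D (Suc (m + i)) = \<dots>" .
  qed
  also have "\<dots> = x ^ m * (x + 1) ^ m - (-1) ^ m * (x ^ m * ((-x) + 1) ^ m)"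
    by (simp only: binomial_ring sum_subtractf sum_distrib_left power_one mult_1_right)
  finally show ?thesis
    by (simp add: add.commute)
qed

lemma beta_poly_eq_bernoulli_sum:
  "\<exists>c :: 'a :: field_char_0. [:0, 1:] ^ m * [:1, -1:] ^ m =
     [:c:] + smult ((-1) ^ m) (\<Sum>j = m+1..2*m. smult (beta_coeff m j) (bernoulli_pol j))"
proof -
  define G :: "'a poly" where "G = (\<Sum>j = m+1..2*m. smult (beta_coeff m j) (bernoulli_pol j))"
  define p where "p = [:0, 1:] ^ m * [:1, -1:] ^ m - smult ((-1) ^ m) G"
  have G: "poly G (x + 1) - poly G x = x ^ m * (1 + x) ^ m - (-1) ^ m * (x ^ m * (1 - x) ^ m)" for x
    using beta_coeff_bernoulli_diff[of m x]
    by (simp add: G_def poly_sum poly_bernoulli_pol sum_subtractf[symmetric] right_diff_distrib)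
  have "poly p (x + 1) - poly p x = 0" for x
  proof -
    have sq: "(-1) ^ m * ((-1) ^ m * a) = a" for a :: 'a
      by (simp add: mult.assoc[symmetric] power_mult_distrib[symmetric])
    have "poly p (x + 1) - poly p x =
        (x + 1) ^ m * (-x) ^ m - x ^ m * (1 - x) ^ m - (-1) ^ m * (poly G (x + 1) - poly G x)"
      by (simp add: p_def algebra_simps)
    also have "\<dots> = 0"
      unfolding G right_diff_distrib sq by (simp add: power_minus[of x m] add.commute)
    finally show ?thesis .
  qed
  hence "p = [:poly p 0:]"
    by (intro poly_periodic_imp_const) simp
  hence "[:0, 1:] ^ m * [:1, -1:] ^ m = [:poly p 0:] + smult ((-1) ^ m) G"
    unfolding p_def by (simp add: algebra_simps)
  thus ?thesis
    unfolding G_def by blast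
qed

section \<open>Higher derivatives\<close>

lemma higher_deriv_poly:
  "(deriv ^^ k) (poly p) = poly ((pderiv ^^ k) p)" for p :: "'a :: real_normed_field poly"
  by (induction k) (auto intro!: DERIV_imp_deriv)

theorem mainTheorem7:
  fixes m k :: nat and x :: "'a :: real_normed_field"
  assumes "m \<ge> 1" and "1 \<le> k" and "k \<le> 2 * m"
  shows "(deriv ^^ k) (\<lambda>y :: 'a. y ^ m * (1 - y) ^ m) x
           = (-1) ^ m * (\<Sum>j = max k (m + 1)..2 * m.
               (1 + (-1) ^ j) / of_nat j * of_nat (m choose (j - m - 1))
                 * (fact j / fact (j - k)) * bernoulli_poly (j - k) x)
       \<and> (-1) ^ m * (\<Sum>j = max k (m + 1)..2 * m.
               (1 + (-1) ^ j) / of_nat j * of_nat (m choose (j - m - 1))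
                 * (fact j / fact (j - k)) * bernoulli_poly (j - k) x)
           = (-1) ^ m * fact k * (\<Sum>j = max k (m + 1)..2 * m.
               (1 + (-1) ^ j) / of_nat j * of_nat (m choose (j - m - 1))
                 * of_nat (j choose k) * bernoulli_poly (j - k) x)"
proof -
  define G :: "'a poly" where "G = (\<Sum>j = m+1..2*m. smult (beta_coeff m j) (bernoulli_pol j))"
  obtain c :: 'a where c: "[:0, 1:] ^ m * [:1, -1:] ^ m = [:c:] + smult ((-1) ^ m) G"
    using beta_poly_eq_bernoulli_sum[of m] unfolding G_def by blast
  have "(pderiv ^^ k) [:c:] = 0"
    using higher_pderiv_0[of "k - 1"] \<open>1 \<le> k\<close>
    by (cases k) (simp_all del: funpow.simps add: funpow_Suc_right)
  hence "(pderiv ^^ k) ([:0, 1:] ^ m * [:1, -1:] ^ m) = smult ((-1) ^ m) ((pderiv ^^ k) G)"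
    unfolding c by (simp add: higher_pderiv_add higher_pderiv_smult)
  moreover have "(\<lambda>y :: 'a. y ^ m * (1 - y) ^ m) = poly ([:0, 1:] ^ m * [:1, -1:] ^ m)"
    by (simp add: fun_eq_iff)
  ultimately have "(deriv ^^ k) (\<lambda>y :: 'a. y ^ m * (1 - y) ^ m) x =
      (-1) ^ m * poly ((pderiv ^^ k) G) x"
    by (simp only: higher_deriv_poly poly_smult)
  also have "poly ((pderiv ^^ k) G) x = (\<Sum>j = m+1..2*m. if k \<le> j then
      beta_coeff m j * (fact j / fact (j - k)) * bernoulli_poly (j - k) x else 0)"
    unfolding G_def higher_pderiv_sum poly_sum
    by (intro sum.cong refl)
       (simp add: higher_pderiv_smult higher_pderiv_bernoulli_pol poly_bernoulli_pol)
  also have "\<dots> = (\<Sum>j = max k (m + 1)..2 * m.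
      beta_coeff m j * (fact j / fact (j - k)) * bernoulli_poly (j - k) x)"
    by (intro sum.mono_neutral_cong_right) auto
  finally have deriv_eq: "(deriv ^^ k) (\<lambda>y :: 'a. y ^ m * (1 - y) ^ m) x =
      (-1) ^ m * (\<Sum>j = max k (m + 1)..2 * m.
        beta_coeff m j * (fact j / fact (j - k)) * bernoulli_poly (j - k) x)" .
  have "(\<Sum>j = max k (m + 1)..2 * m.
        beta_coeff m j * (fact j / fact (j - k)) * bernoulli_poly (j - k) x) =
      fact k * (\<Sum>j = max k (m + 1)..2 * m.
        beta_coeff m j * of_nat (j choose k) * bernoulli_poly (j - k) x)"
    unfolding sum_distrib_left by (intro sum.cong refl) (simp add: binomial_fact)
  with deriv_eq show ?thesis
    unfolding beta_coeff_def by (simp only: mult.assoc)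
qed

end
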